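(* Let $q=2n+1\ge 7$ be an odd prime power with $q\equiv 1\pmod 4$, and let $\chi_q$ be a generator of the group $\widehat{\mathbb{F}_q^{\times}}$ of multiplicative characters of $\mathbb{F}_q$. Let $$I_q(\chi_q)=\prod_{0<k<n/2}\left(J_q(\phi,\chi_q^k)-J_q(\phi,\chi_q^{-k})\right).$$ Then $$y_q:=\boldsymbol{i}^{\frac{n-2}{2}}\cdot I_q(\chi_q)\cdot\sqrt{q-1}\in\mathbb{Z}.$$ Moreover, for every nonsquare $d\in\mathbb{F}_q^{\times}$, $$-a_d(q)\cdot y_q^2=2^n\cdot\det T_q(d),$$ where $T_q(d)=\left[\phi(s_i+ds_j)\right]_{0\le i,j\le n}$ and $a_d(q)=-\sum_{x\in\mathbb{F}_q}\phi(dx^3+x)$.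
   Context: $\mathbb{F}_q$ is the finite field with $q=2n+1$ elements, $q$ an odd prime power. $\widehat{\mathbb{F}_q^{\times}}$ is the cyclic group (of order $q-1$) of complex-valued multiplicative characters of $\mathbb{F}_q^\times$; every character $\chi_q^k$ (including the trivial one) is extended to $\mathbb{F}_q$ by $\chi_q^k(0)=0$. $\phi=\chi_q^{n}$ is the quadratic character: $\phi(x)=1$ if $x$ is a nonzero square, $\phi(0)=0$, $\phi(x)=-1$ if $x$ is a nonsquare. The Jacobi sum is $J_q(\chi_q^i,\chi_q^j)=\sum_{x\in\mathbb{F}_q}\chi_q^i(x)\chi_q^j(1-x)$. The set of squares of $\mathbb{F}_q$ is enumerated as $\{x^2:x\in\mathbb{F}_q\}=\{s_0=0,s_1=1,s_2,\dots,s_n\}$ with the $s_i$ distinct. The product defining $I_q(\chi_q)$ runs over integers $k$ with $0<k<n/2$. $\boldsymbol{i}$ is the imaginary unit (primitive 4th root of unity with argument $\pi/2$). The number $a_d(q)$ is the trace of Frobenius of the elliptic curve $X_d: y^2=dx^3+x$ over $\mathbb{F}_q$, i.e. $\#X_d(\mathbb{F}_q)=q+1-a_d(q)$ (counting the point at infinity). *)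

theory Defs
  imports Complex_Main "HOL-Library.Cardinality" "Jordan_Normal_Form.Determinant"
begin

text \<open>
  The finite field is a type \<open>'a\<close> of class \<open>{finite, field}\<close>, of cardinality \<open>q = CARD('a)\<close>
  (automatically a prime power). Characters are functions on all of \<open>'a\<close>, extended by 0 at 0.
\<close>

definition mult_char :: "('a::{finite,field} \<Rightarrow> complex) \<Rightarrow> bool" where
  "mult_char chi \<longleftrightarrow>
     chi 0 = 0 \<and> (\<forall>x. x \<noteq> 0 \<longrightarrow> chi x \<noteq> 0) \<and>
     (\<forall>x y. x \<noteq> 0 \<longrightarrow> y \<noteq> 0 \<longrightarrow> chi (x * y) = chi x * chi y)"

text \<open>The case distinction makes the trivial character (\<open>k = 0\<close>) vanish at 0 too.\<close>

definition char_power :: "('a::{finite,field} \<Rightarrow> complex) \<Rightarrow> int \<Rightarrow> 'a \<Rightarrow> complex" where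
  "char_power chi k x = (if x = 0 then 0 else chi x powi k)"

definition char_generator :: "('a::{finite,field} \<Rightarrow> complex) \<Rightarrow> bool" where
  "char_generator chi \<longleftrightarrow>
     mult_char chi \<and> (\<forall>psi. mult_char psi \<longrightarrow> (\<exists>k::int. psi = char_power chi k))"

definition squares :: "'a::{finite,field} set" where
  "squares = {x ^ 2 | x. True}"

definition quad_char :: "'a::{finite,field} \<Rightarrow> complex" where
  "quad_char x = (if x = 0 then 0 else if x \<in> squares then 1 else - 1)"

definition jacobi_sum ::
    "('a::{finite,field} \<Rightarrow> complex) \<Rightarrow> ('a \<Rightarrow> complex) \<Rightarrow> complex" where
  "jacobi_sum f g = (\<Sum>x\<in>UNIV. f x * g (1 - x))"

definition I_prod :: "nat \<Rightarrow> ('a::{finite,field} \<Rightarrow> complex) \<Rightarrow> complex" where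
  "I_prod n chi =
     (\<Prod>k\<in>{k::int. 0 < k \<and> real_of_int k < real n / 2}.
        jacobi_sum quad_char (char_power chi k) - jacobi_sum quad_char (char_power chi (- k)))"

text \<open>Used only for even \<open>n \<ge> 2\<close>, where the natural-number exponent is exactly \<open>(n - 2) / 2\<close>.\<close>

definition y_val :: "nat \<Rightarrow> ('a::{finite,field} \<Rightarrow> complex) \<Rightarrow> complex" where
  "y_val n chi =
     \<i> ^ ((n - 2) div 2) * I_prod n chi * complex_of_real (sqrt (real CARD('a) - 1))"

text \<open>Rational points of \<open>y\<^sup>2 = d x\<^sup>3 + x\<close>; \<open>None\<close> is the point at infinity.\<close>

definition X_points :: "'a::{finite,field} \<Rightarrow> ('a \<times> 'a) option set" where
  "X_points d = insert None (Some ` {(x, y). y ^ 2 = d * x ^ 3 + x})"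

definition frob_trace :: "'a::{finite,field} \<Rightarrow> int" where
  "frob_trace d = int CARD('a) + 1 - int (card (X_points d))"

definition T_mat :: "nat \<Rightarrow> (nat \<Rightarrow> 'a::{finite,field}) \<Rightarrow> 'a \<Rightarrow> complex mat" where
  "T_mat n s d = mat (n + 1) (n + 1) (\<lambda>(i, j). quad_char (s i + d * s j))"

end

theory Submission
  imports Defs "HOL-Algebra.Algebraic_Closure_Type"
begin

text \<open>
  Write \<open>n = 2 N\<close>, \<open>D\<^sub>k = J(\<phi>, \<chi>\<^sup>k) - J(\<phi>, \<chi>\<^bsup>-k\<^esup>)\<close>, and normalise a generator \<open>g\<close> of the multiplicative
  group so that \<open>\<chi>(g) = exp(\<pi> i / n)\<close>. Substituting \<open>u \<mapsto> 1/u\<close> in one Jacobi sum gives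
  \<open>D\<^sub>k = 2 \<Sum> \<phi>(1 - u) \<chi>\<^sup>k(u)\<close>, the sum over nonsquares \<open>u\<close>.

  Integrality: with \<open>u = g\<^bsup>2i+1\<^esup>\<close> the coefficients \<open>\<phi>(1 - u)\<close> are antisymmetric under
  \<open>i \<mapsto> n - 1 - i\<close>, so \<open>D\<^sub>k = 4 i sin(\<pi>k/n) P(2 cos(\<pi>k/N))\<close> with \<open>P\<close> an integer polynomial.
  The product of the \<open>2 sin(\<pi>k/n)\<close> over \<open>0 < k < N\<close> is \<open>\<surd>N\<close>, which combines with
  \<open>\<surd>(q - 1) = 2 \<surd>N\<close> to an integer. The numbers \<open>2 cos(\<pi>k/N)\<close> are the eigenvalues of the
  adjacency matrix \<open>A\<close> of a path, so the product of the \<open>P(2 cos(\<pi>k/N))\<close> is \<open>det P(A)\<close>.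

  Determinant: \<open>[\<phi>(s\<^sub>i + d s\<^sub>j)]\<close> with \<open>i, j \<ge> 1\<close> is a circulant for the group of nonzero squares,
  with eigenvalues \<open>\<mu>\<^sub>k = \<chi>\<^bsup>-k\<^esup>(-d) D\<^sub>k / 2\<close>. Since \<open>\<mu>\<^sub>0 = 0\<close>, the border only contributes the
  eigenvalues \<open>\<plusminus> i \<surd>n\<close>. Finally \<open>\<mu>\<^sub>k \<mu>\<^bsub>n-k\<^esub> = - D\<^sub>k\<^sup>2 / 4\<close>, and \<open>\<mu>\<^sub>N = - a\<^sub>d / 2\<close>.
\<close>

section \<open>Determinants and trigonometric products\<close>

lemma det_diag_fun:
  fixes lam :: "nat \<Rightarrow> 'a :: comm_ring_1"
  shows "Determinant.det (mat m m (\<lambda>(i, j). if i = j then lam i else 0)) = (\<Prod>k<m. lam k)"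
  by (subst det_upper_triangular[where n = m])
     (auto simp: prod_list_diag_prod atLeast0LessThan)

lemma mat_fun_mult:
  "mat m m (\<lambda>(i, j). a i j) * mat m m (\<lambda>(i, j). b i j) =
     mat m m (\<lambda>(i, j). \<Sum>l<m. a i l * b l j)"
  by (rule eq_matI) (auto simp: scalar_prod_def atLeast0LessThan)

text \<open>The eigenvector equations say \<open>a v = v diag(lam)\<close>, and \<open>det v\<close>
  can be cancelled because \<open>x v\<close> is diagonal with nonzero entries. Asking only for an
  inverse up to the scaling \<open>c\<close> lets orthogonality relations be used as they
  come.\<close>

lemma det_eq_prod_eigenvalues:
  fixes a v x :: "nat \<Rightarrow> nat \<Rightarrow> 'a :: field"
  assumes eig: "\<And>i k. i < m \<Longrightarrow> k < m \<Longrightarrow> (\<Sum>j<m. a i j * v j k) = lam k * v i k"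
    and inv: "\<And>i k. i < m \<Longrightarrow> k < m \<Longrightarrow> (\<Sum>j<m. x i j * v j k) = (if i = k then c i else 0)"
    and nz: "\<And>k. k < m \<Longrightarrow> c k \<noteq> 0"
  shows "Determinant.det (mat m m (\<lambda>(i, j). a i j)) = (\<Prod>k<m. lam k)"
proof -
  define M where "M = (\<lambda>f :: nat \<Rightarrow> nat \<Rightarrow> 'a. mat m m (\<lambda>(i, j). f i j))"
  have M [simp]: "M f \<in> carrier_mat m m" for f
    by (simp add: M_def)
  have detM: "Determinant.det (M f * M g) = Determinant.det (M f) * Determinant.det (M g)" for f g
    by (rule det_mult[OF M M])
  have detD: "Determinant.det (M (\<lambda>i j. if i = j then f i else 0)) = (\<Prod>k<m. f k)" for f
    unfolding M_def by (rule det_diag_fun)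
  let ?L = "M (\<lambda>i j. if i = j then lam i else 0)"
  have "M x * M v = M (\<lambda>i j. if i = j then c i else 0)"
    unfolding M_def mat_fun_mult by (rule cong_mat) (auto simp: inv)
  then have "Determinant.det (M x) * Determinant.det (M v) = (\<Prod>k<m. c k)"
    by (simp flip: detM detD)
  moreover have "(\<Prod>k<m. c k) \<noteq> 0" using nz by simp
  ultimately have v: "Determinant.det (M v) \<noteq> 0" by auto
  have "M a * M v = M v * ?L"
    unfolding M_def mat_fun_mult
    by (rule cong_mat) (auto simp: eig if_distrib sum.delta cong: if_cong)
  then have "Determinant.det (M a) * Determinant.det (M v) =
      Determinant.det (M v) * (\<Prod>k<m. lam k)"
    by (simp flip: detM detD)
  with v show ?thesis by (simp add: M_def)
qed

section \<open>Products of sines from roots of unity\<close>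

lemma prod_one_minus_roots_of_unity:
  fixes m :: nat
  assumes m: "m > 0"
  shows "(\<Prod>k=1..<m. 1 - cis (2 * pi * real k / real m)) = of_nat m"
proof -
  define w where "w = (\<lambda>k. cis (2 * pi * real k / real m))"
  have bij: "bij_betw w {..<m} {z. z ^ m = 1}"
    unfolding w_def by (rule bij_betw_roots_unity[OF m])
  then have inj: "inj_on w {..<m}" by (simp add: bij_betw_def)
  let ?p = "\<Prod>k=1..<m. [:- w k, 1:]" and ?q = "\<Sum>j<m. Polynomial.monom (1::complex) j"
  have deg: "Polynomial.degree ?p = m - 1"
    by (subst degree_prod_eq_sum_degree) auto
  \<comment> \<open>Both sides are monic of degree \<open>m - 1\<close> and vanish at the
    \<open>m - 1\<close> nontrivial roots of unity; the claim is this identity evaluated at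
    1.\<close>
  have "?p = ?q"
  proof (rule poly_eqI_degree_lead_coeff[where n = "m - 1" and A = "w ` {1..<m}"])
    have "Polynomial.lead_coeff ?p = 1" by (subst lead_coeff_prod) auto
    then have "poly.coeff ?p (m - 1) = 1" unfolding deg .
    moreover have "poly.coeff ?q (m - 1) = 1"
      using m by (simp add: coeff_sum)
    ultimately show "poly.coeff ?p (m - 1) = poly.coeff ?q (m - 1)" by simp
    show "card (w ` {1..<m}) \<ge> m - 1"
      by (subst card_image) (auto intro: inj_on_subset[OF inj])
    show "Polynomial.degree ?p \<le> m - 1" by (simp only: deg)
    show "Polynomial.degree ?q \<le> m - 1"
      by (rule degree_sum_le) (auto simp: Polynomial.degree_monom_eq)
    fix z assume "z \<in> w ` {1..<m}"
    then obtain k where k: "k \<in> {1..<m}" "z = w k" by blast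
    have "poly ?p z = 0"
      unfolding poly_prod using k by (intro prod_zero bexI[of _ k]) auto
    moreover have "z ^ m = 1" using bij k by (auto simp: bij_betw_def)
    moreover have "z \<noteq> 1"
    proof
      assume "z = 1"
      then have "w k = w 0" using k by (simp add: w_def)
      then have "k = 0" using inj k m unfolding inj_on_def by auto
      then show False using k by simp
    qed
    ultimately show "poly ?p z = poly ?q z"
      by (simp add: poly_sum Polynomial.poly_monom sum_gp_strict)
  qed
  then have "poly ?p 1 = poly ?q 1" by simp
  then show ?thesis by (simp add: poly_prod poly_sum Polynomial.poly_monom w_def)
qed

text \<open>Take norms in the product over roots of unity: \<open>1 - cis (2 * t)\<close> has norm
  \<open>2 * sin t\<close> for \<open>0 < t < pi\<close>.\<close>

lemma prod_sin:
  assumes m: "m > 0"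
  shows "(\<Prod>k=1..<m. 2 * sin (pi * real k / real m)) = real m"
proof -
  have "norm (1 - cis (2 * pi * real k / real m)) = 2 * sin (pi * real k / real m)"
    if "k \<in> {1..<m}" for k
  proof -
    define t where "t = pi * real k / real m"
    have "0 < t" "t < pi" using that by (auto simp: t_def field_simps)
    then have s: "sin t > 0" by (rule sin_gt_zero)
    have "1 - cis (2 * t) = - 2 * \<i> * sin t * cis t"
      by (simp add: complex_eq_iff cos_double sin_double power2_eq_square)
         (simp add: cos_squared_eq power2_eq_square[symmetric])
    then have "norm (1 - cis (2 * t)) = 2 * sin t"
      using s by (simp add: norm_mult)
    then show ?thesis by (simp add: t_def mult.assoc)
  qed
  then have "(\<Prod>k=1..<m. 2 * sin (pi * real k / real m)) =
      norm (\<Prod>k=1..<m. 1 - cis (2 * pi * real k / real m))"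
    unfolding prod_norm[symmetric] by (intro prod.cong) auto
  also have "\<dots> = real m" using prod_one_minus_roots_of_unity[OF m] by simp
  finally show ?thesis .
qed

text \<open>The full product \<open>2 * N\<close> is symmetric about \<open>k = N\<close>, where the
  factor is 2, so the half product squares to \<open>N\<close>. Nonnegativity of the factors selects
  the root.\<close>

lemma prod_sin_half:
  assumes N: "N > 0"
  shows "(\<Prod>k=1..<N. 2 * sin (pi * real k / real (2 * N))) = sqrt (real N)"
proof -
  define h where "h k = 2 * sin (pi * real k / real (2 * N))" for k
  have refl: "h (2 * N - k) = h k" if "k < 2 * N" for k
  proof -
    have "pi * real (2 * N - k) / real (2 * N) = pi - pi * real k / real (2 * N)"
      using that by (simp add: field_simps of_nat_diff)
    then show ?thesis by (simp add: h_def)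
  qed
  have "real (2 * N) = (\<Prod>k=1..<2*N. h k)"
    using prod_sin[of "2 * N"] N by (simp add: h_def)
  also have "{1..<2*N} = insert N ({1..<N} \<union> {N<..<2*N})" using N by auto
  also have "prod h \<dots> = h N * (prod h {1..<N} * prod h {N<..<2*N})"
    by (subst prod.insert, simp, simp, subst prod.union_disjoint) auto
  also have "prod h {N<..<2*N} = prod h {1..<N}"
    by (rule prod.reindex_bij_witness[of _ "\<lambda>k. 2 * N - k" "\<lambda>k. 2 * N - k"])
       (auto simp: refl)
  also have "h N = 2" using N by (simp add: h_def)
  finally have "(prod h {1..<N})\<^sup>2 = real N" by (simp add: power2_eq_square)
  moreover have "prod h {1..<N} \<ge> 0"
    by (rule prod_nonneg) (auto simp: h_def field_simps intro!: sin_ge_zero)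
  ultimately show ?thesis by (simp add: h_def real_sqrt_unique)
qed

section \<open>Dirichlet kernels and integer spectra\<close>

text \<open>The kernel \<open>sin((2i + 1) t) / sin t\<close> as a polynomial in \<open>x = 2 cos(2t)\<close>.\<close>

fun dirichlet_kernel :: "nat \<Rightarrow> real \<Rightarrow> real" where
  "dirichlet_kernel 0 x = 1"
| "dirichlet_kernel (Suc 0) x = x + 1"
| "dirichlet_kernel (Suc (Suc i)) x = x * dirichlet_kernel (Suc i) x - dirichlet_kernel i x"

text \<open>The recursion of the kernel is the identity sin(a + 2t) + sin(a - 2t) = 2 cos(2t)
  sin(a). Multiplying through by \<open>sin t\<close> avoids a division.\<close>

lemma sin_odd_multiple:
  "sin (real (2 * i + 1) * t) = sin t * dirichlet_kernel i (2 * cos (2 * t))"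
proof (induction i "2 * cos (2 * t)" rule: dirichlet_kernel.induct)
  case 2
  have "sin (2 * t + t) - sin (2 * t - t) = 2 * cos (2 * t) * sin t"
    by (simp only: sin_add sin_diff)
  then show ?case by (simp add: algebra_simps)
next
  case (3 i)
  have "sin (real (2 * Suc (Suc i) + 1) * t) = sin (real (2 * Suc i + 1) * t + 2 * t)"
       "sin (real (2 * i + 1) * t) = sin (real (2 * Suc i + 1) * t - 2 * t)"
    by (simp_all add: algebra_simps)
  then have "sin (real (2 * Suc (Suc i) + 1) * t) =
      2 * cos (2 * t) * sin (real (2 * Suc i + 1) * t) - sin (real (2 * i + 1) * t)"
    by (simp add: sin_add sin_diff)
  with 3 show ?case by (simp add: algebra_simps)
qed simp

text \<open>
  \<open>h\<close> is the spectrum of an integer matrix whose eigenvectors are the columns of \<open>v\<close>. For fixed \<open>v\<close>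
  such \<open>h\<close> form a ring, which replaces evaluating integer polynomials at a matrix.
\<close>

definition int_diagonal :: "nat \<Rightarrow> (nat \<Rightarrow> nat \<Rightarrow> real) \<Rightarrow> (nat \<Rightarrow> real) \<Rightarrow> bool" where
  "int_diagonal m v h \<longleftrightarrow>
     (\<exists>b :: nat \<Rightarrow> nat \<Rightarrow> int. \<forall>i<m. \<forall>k<m. (\<Sum>j<m. of_int (b i j) * v j k) = h k * v i k)"

lemma int_diagonal_1: "int_diagonal m v (\<lambda>_. 1)"
  unfolding int_diagonal_def
  by (rule exI[of _ "\<lambda>i j. if i = j then 1 else 0"])
     (simp add: if_distrib[of of_int] if_distrib[of "\<lambda>x. x * _"] sum.delta cong: if_cong)

lemma int_diagonal_lincomb:
  assumes "int_diagonal m v h" "int_diagonal m v h'"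
  shows "int_diagonal m v (\<lambda>k. of_int r * h k + of_int r' * h' k)"
proof -
  from assms(1) obtain b :: "nat \<Rightarrow> nat \<Rightarrow> int" where
    b: "\<forall>i<m. \<forall>k<m. (\<Sum>j<m. of_int (b i j) * v j k) = h k * v i k"
    unfolding int_diagonal_def ..
  from assms(2) obtain b' :: "nat \<Rightarrow> nat \<Rightarrow> int" where
    b': "\<forall>i<m. \<forall>k<m. (\<Sum>j<m. of_int (b' i j) * v j k) = h' k * v i k"
    unfolding int_diagonal_def ..
  have "(\<Sum>j<m. of_int (r * b i j + r' * b' i j) * v j k) =
      (of_int r * h k + of_int r' * h' k) * v i k" if "i < m" "k < m" for i k
  proof -
    have "(\<Sum>j<m. of_int (r * b i j + r' * b' i j) * v j k) =
        of_int r * (\<Sum>j<m. of_int (b i j) * v j k) + of_int r' * (\<Sum>j<m. of_int (b' i j) * v j k)"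
      by (simp add: sum.distrib sum_distrib_left algebra_simps)
    then show ?thesis using that by (simp only: b[rule_format] b'[rule_format]) (simp add: algebra_simps)
  qed
  then show ?thesis unfolding int_diagonal_def
    by (intro exI[of _ "\<lambda>i j. r * b i j + r' * b' i j"]) blast
qed

text \<open>The product of the two integer matrices is the witness: the columns of \<open>v\<close>
  are eigenvectors of both, so the eigenvalues multiply.\<close>

lemma int_diagonal_mult:
  assumes "int_diagonal m v h" "int_diagonal m v h'"
  shows "int_diagonal m v (\<lambda>k. h k * h' k)"
proof -
  from assms(1) obtain b :: "nat \<Rightarrow> nat \<Rightarrow> int" where
    b: "\<forall>i<m. \<forall>k<m. (\<Sum>j<m. of_int (b i j) * v j k) = h k * v i k"
    unfolding int_diagonal_def ..
  from assms(2) obtain b' :: "nat \<Rightarrow> nat \<Rightarrow> int" where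
    b': "\<forall>i<m. \<forall>k<m. (\<Sum>j<m. of_int (b' i j) * v j k) = h' k * v i k"
    unfolding int_diagonal_def ..
  have "(\<Sum>j<m. of_int (\<Sum>l<m. b i l * b' l j) * v j k) = h k * h' k * v i k"
    if "i < m" "k < m" for i k
  proof -
    have "(\<Sum>j<m. of_int (\<Sum>l<m. b i l * b' l j) * v j k) =
        (\<Sum>j<m. \<Sum>l<m. of_int (b i l) * (of_int (b' l j) * v j k))"
      by (simp add: sum_distrib_right mult.assoc)
    also have "\<dots> = (\<Sum>l<m. of_int (b i l) * (\<Sum>j<m. of_int (b' l j) * v j k))"
      by (subst sum.swap) (simp add: sum_distrib_left)
    also have "\<dots> = (\<Sum>l<m. of_int (b i l) * (h' k * v l k))"
      using that by (simp add: b')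
    also have "\<dots> = h' k * (\<Sum>l<m. of_int (b i l) * v l k)"
      by (simp add: sum_distrib_left mult_ac)
    finally show ?thesis using that by (simp only: b[rule_format]) (simp add: mult_ac)
  qed
  then show ?thesis unfolding int_diagonal_def
    by (intro exI[of _ "\<lambda>i j. \<Sum>l<m. b i l * b' l j"]) blast
qed

lemma int_diagonal_sum:
  fixes c :: "nat \<Rightarrow> int"
  assumes "\<And>i. i < r \<Longrightarrow> int_diagonal m v (h i)"
  shows "int_diagonal m v (\<lambda>k. \<Sum>i<r. of_int (c i) * h i k)"
  using assms
proof (induction r)
  case 0
  \<comment> \<open>The empty sum is the combination with both coefficients 0.\<close>
  show ?case using int_diagonal_lincomb[OF int_diagonal_1 int_diagonal_1, of m v 0 0] by simp
next
  case (Suc r)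
  then show ?case
    using int_diagonal_lincomb[of m v "\<lambda>k. \<Sum>i<r. of_int (c i) * h i k" "h r" 1 "c r"] by simp
qed

lemma int_diagonal_dirichlet_kernel:
  assumes "int_diagonal m v x"
  shows "int_diagonal m v (\<lambda>k. dirichlet_kernel i (x k))"
proof (induction i rule: less_induct)
  case (less i)
  consider "i = 0" | "i = 1" | i' where "i = Suc (Suc i')"
    by (metis One_nat_def not0_implies_Suc)
  then show ?case
  proof cases
    case 1
    then show ?thesis by (simp add: int_diagonal_1)
  next
    case 2
    then show ?thesis
      using int_diagonal_lincomb[OF assms int_diagonal_1, of 1 1] by simp
  next
    case 3
    then have "int_diagonal m v (\<lambda>k. dirichlet_kernel i' (x k))"
      "int_diagonal m v (\<lambda>k. dirichlet_kernel (Suc i') (x k))"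
      using less by simp_all
    then show ?thesis
      using int_diagonal_lincomb[OF int_diagonal_mult[OF assms], of _ _ 1 "-1"] 3 by simp
  qed
qed

text \<open>The product of the spectrum is the determinant of an integer matrix.\<close>

lemma int_diagonal_prod:
  assumes h: "int_diagonal m v h"
    and inv: "\<And>i k. i < m \<Longrightarrow> k < m \<Longrightarrow> (\<Sum>j<m. x i j * v j k) = (if i = k then c i else 0)"
    and nz: "\<And>k. k < m \<Longrightarrow> c k \<noteq> 0"
  shows "(\<Prod>k<m. h k) \<in> \<int>"
proof -
  from h obtain b :: "nat \<Rightarrow> nat \<Rightarrow> int" where
    b: "\<forall>i<m. \<forall>k<m. (\<Sum>j<m. of_int (b i j) * v j k) = h k * v i k"
    unfolding int_diagonal_def ..
  have "(\<Prod>k<m. h k) = Determinant.det (mat m m (\<lambda>(i, j). real_of_int (b i j)))"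
    using det_eq_prod_eigenvalues[OF b[rule_format] inv nz] by simp
  also have "mat m m (\<lambda>(i, j). real_of_int (b i j)) =
      map_mat of_int (mat m m (\<lambda>(i, j). b i j))"
    by (rule eq_matI) auto
  also have "Determinant.det \<dots> = of_int (Determinant.det (mat m m (\<lambda>(i, j). b i j)))"
    by (rule of_int_hom.hom_det)
  finally show ?thesis by simp
qed

section \<open>Orthogonality of sines and the spectrum of a path\<close>

lemma cis_eq_1_iff_dvd:
  assumes "m > 0"
  shows "cis (2 * pi * real_of_int r / real m) = 1 \<longleftrightarrow> int m dvd r"
proof
  assume "cis (2 * pi * real_of_int r / real m) = 1"
  then have "cos (2 * pi * real_of_int r / real m) = 1" by (simp add: complex_eq_iff)
  then obtain j :: int where "2 * pi * real_of_int r / real m = real_of_int j * 2 * pi"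
    unfolding cos_one_2pi_int by blast
  then have "real_of_int r = real_of_int (int m * j)"
    using assms by (simp add: field_simps)
  then have "r = int m * j" by linarith
  then show "int m dvd r" by simp
next
  assume "int m dvd r"
  then obtain j where "r = int m * j" by auto
  then have "2 * pi * real_of_int r / real m = 2 * pi * real_of_int j" using assms by simp
  then show "cis (2 * pi * real_of_int r / real m) = 1" by (simp add: cis_multiple_2pi)
qed

text \<open>This is the real part of a geometric sum whose ratio is a \<open>2 * N\<close>-th root
  of unity.\<close>

lemma sum_cos_period:
  assumes N: "N > 0"
  shows "(\<Sum>l<2*N. cos (pi * real_of_int r * real l / real N)) =
    (if int (2 * N) dvd r then 2 * real N else 0)"
proof -
  define w where "w = cis (2 * pi * real_of_int r / real (2 * N))"
  have cos: "cos (pi * real_of_int r * real l / real N) = Re (w ^ l)" for l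
    by (simp add: w_def DeMoivre mult_ac)
  have "real (2 * N) * (2 * pi * real_of_int r / real (2 * N)) = 2 * pi * real_of_int r"
    using N by simp
  then have w1: "w ^ (2 * N) = 1"
    by (simp only: w_def DeMoivre cis_multiple_2pi[OF Ints_of_int])
  have "(\<Sum>l<2*N. cos (pi * real_of_int r * real l / real N)) = Re (\<Sum>l<2*N. w ^ l)"
    by (simp add: cos)
  also have "\<dots> = (if w = 1 then 2 * real N else 0)"
    using w1 by (simp add: sum_gp_strict)
  also have "w = 1 \<longleftrightarrow> int (2 * N) dvd r"
    unfolding w_def by (rule cis_eq_1_iff_dvd) (use N in simp)
  finally show ?thesis .
qed

text \<open>The summand is invariant under \<open>l \<mapsto> 2 * N - l\<close> and vanishes at 0
  and \<open>N\<close>, so the sum is half of that over a full period. There the product formula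
  leaves two cosine sums, with frequencies \<open>k - k'\<close> and \<open>k + k'\<close>.\<close>

lemma sum_sin_sin:
  assumes "k \<in> {1..<N}" "k' \<in> {1..<N}"
  shows "(\<Sum>l=1..<N. sin (pi * real k * real l / real N) * sin (pi * real k' * real l / real N)) =
    (if k = k' then real N / 2 else 0)"
proof -
  define h where "h l = sin (pi * real k * real l / real N) * sin (pi * real k' * real l / real N)" for l
  have N: "N > 0" using assms by simp
  have s: "sin (pi * real m * real (2 * N - l) / real N) = - sin (pi * real m * real l / real N)"
    if "l < 2 * N" for l m
  proof -
    have "pi * real m * real (2 * N - l) / real N =
        2 * pi * real_of_int (int m) - pi * real m * real l / real N"
      using that by (simp add: field_simps)
    then show ?thesis by (simp only: sin_diff sin_int_2pin cos_int_2pin)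
  qed
  have refl: "h (2 * N - l) = h l" if "l < 2 * N" for l
    using that by (simp only: h_def s minus_mult_minus)
  have "h l = (cos (pi * real_of_int (int k - int k') * real l / real N) -
      cos (pi * real_of_int (int k + int k') * real l / real N)) / 2" for l
    unfolding h_def sin_times_sin
    by (simp add: diff_divide_distrib add_divide_distrib algebra_simps)
  then have "(\<Sum>l<2*N. h l) = ((if int (2 * N) dvd int k - int k' then 2 * real N else 0) -
      (if int (2 * N) dvd int k + int k' then 2 * real N else 0)) / 2"
    by (simp only: sum_divide_distrib[symmetric] sum_subtractf sum_cos_period[OF N])
  also have "int (2 * N) dvd int k - int k' \<longleftrightarrow> k = k'"
  proof
    assume "int (2 * N) dvd int k - int k'"
    moreover have "\<bar>int k - int k'\<bar> < int (2 * N)" using assms by auto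
    ultimately have "int k - int k' = 0"
      using dvd_imp_le_int[of "int k - int k'" "int (2 * N)"] by linarith
    then show "k = k'" by simp
  qed simp
  also have "int (2 * N) dvd int k + int k' \<longleftrightarrow> False"
    using assms zdvd_not_zless[of "int k + int k'" "int (2 * N)"] by auto
  finally have "(\<Sum>l<2*N. h l) = (if k = k' then real N else 0)"
    by (cases "k = k'") simp_all
  also have "{..<2*N} = insert 0 (insert N ({1..<N} \<union> {N<..<2*N}))" using N by auto
  also have "sum h \<dots> = h 0 + (h N + (sum h {1..<N} + sum h {N<..<2*N}))"
    using N by (subst sum.insert, simp, simp, subst sum.insert, simp, simp, subst sum.union_disjoint) auto
  also have "sum h {N<..<2*N} = sum h {1..<N}"
    by (rule sum.reindex_bij_witness[of _ "\<lambda>k. 2 * N - k" "\<lambda>k. 2 * N - k"])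
       (auto simp: refl)
  also have "h 0 = 0" by (simp add: h_def)
  also have "h N = 0" using N by (simp add: h_def mult.commute[of pi])
  finally show ?thesis by (cases "k = k'") (simp_all add: h_def)
qed

text \<open>One row of the path adjacency matrix applied to a vector. The two end vertices lack a
  neighbour, which the case distinctions record.\<close>

lemma sum_neighbours:
  fixes u :: "nat \<Rightarrow> real"
  assumes "i < m"
  shows "(\<Sum>j<m. of_int (if j = Suc i \<or> i = Suc j then 1 else 0) * u (Suc j)) =
    (if i = 0 then 0 else u i) + (if Suc i = m then 0 else u (Suc (Suc i)))"
proof -
  \<comment> \<open>Subtraction on \<open>nat\<close> truncates, so the left neighbour
    \<open>i - 1\<close> needs the guard \<open>i \<noteq> 0\<close>.\<close>
  have "(\<Sum>j<m. of_int (if j = Suc i \<or> i = Suc j then 1 else 0) * u (Suc j)) =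
      (\<Sum>j<m. (if j = Suc i then u (Suc j) else 0) + (if j = i - 1 \<and> i \<noteq> 0 then u (Suc j) else 0))"
    by (rule sum.cong) auto
  also have "\<dots> = (if Suc i < m then u (Suc (Suc i)) else 0) + (if i = 0 then 0 else u i)"
    using assms by (cases i) (auto simp: sum.distrib)
  finally show ?thesis using assms by auto
qed

text \<open>The numbers \<open>2 * cos (pi * k / N)\<close> with \<open>0 < k < N\<close> are the
  eigenvalues of the path on \<open>N - 1\<close> vertices, with sine vectors as eigenvectors. An
  integer combination of kernels therefore has an integer spectrum in the sense of
  \<open>int_diagonal\<close>.\<close>

lemma prod_dirichlet_combination_Ints:
  fixes f :: "nat \<Rightarrow> int"
  shows "(\<Prod>k=1..<N. \<Sum>i<r. of_int (f i) * dirichlet_kernel i (2 * cos (pi * real k / real N))) \<in> \<int>"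
proof (cases "N = 0")
  case False
  \<comment> \<open>Matrix indices start at 0 while the frequencies and vertices run over
    \<open>1..<N\<close>, hence the shifts by \<open>Suc\<close>.\<close>
  define m where "m = N - 1"
  define v where "v = (\<lambda>j k. sin (pi * real (Suc k) * real (Suc j) / real N))"
  define x where "x = (\<lambda>k. 2 * cos (pi * real (Suc k) / real N))"
  have x: "int_diagonal m v x"
    unfolding int_diagonal_def
    \<comment> \<open>the adjacency matrix of the path on \<open>m\<close> vertices\<close>
  proof (intro exI[of _ "\<lambda>i j. if j = Suc i \<or> i = Suc j then 1 else 0"] allI impI)
    fix i k assume i: "i < m" "k < m"
    define u where "u = (\<lambda>l. sin (pi * real (Suc k) * real l / real N))"
    have u0: "u 0 = 0" by (simp add: u_def)
    have "u N = sin (real (Suc k) * pi)"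
      using False by (simp add: u_def mult.commute[of pi])
    then have uN: "u N = 0" by (simp only: sin_npi)
    have "(\<Sum>j<m. of_int (if j = Suc i \<or> i = Suc j then 1 else 0) * v j k) =
        (if i = 0 then 0 else u i) + (if Suc i = m then 0 else u (Suc (Suc i)))"
      using sum_neighbours[OF i(1), of u] by (simp add: v_def u_def)
    \<comment> \<open>The missing neighbours sit at positions 0 and \<open>N\<close>, where the sine
      vanishes.\<close>
    also have "\<dots> = u i + u (Suc (Suc i))"
      using u0 uN by (auto simp: m_def)
    also have "\<dots> = x k * u (Suc i)"
    proof -
      define t where "t = pi * real (Suc k) / real N"
      have a: "u l = sin (real l * t)" for l by (simp add: u_def t_def mult_ac)
      have "u i = sin (real (Suc i) * t - t)" "u (Suc (Suc i)) = sin (real (Suc i) * t + t)"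
        by (simp_all add: a algebra_simps)
      moreover have "x k = 2 * cos t" by (simp only: x_def t_def)
      ultimately show ?thesis
        by (simp add: sin_add sin_diff a)
    qed
    finally show "(\<Sum>j<m. of_int (if j = Suc i \<or> i = Suc j then 1 else 0) * v j k) = x k * v i k"
      by (simp add: v_def u_def)
  qed
  have "(\<Prod>k<m. \<Sum>i<r. of_int (f i) * dirichlet_kernel i (x k)) \<in> \<int>"
  \<comment> \<open>The symmetric sine matrix is its own inverse up to the factor
    \<open>N / 2\<close>.\<close>
  proof (rule int_diagonal_prod[where v = v and x = v and c = "\<lambda>_. real N / 2" and m = m])
    show "int_diagonal m v (\<lambda>k. \<Sum>i<r. of_int (f i) * dirichlet_kernel i (x k))"
      by (rule int_diagonal_sum) (rule int_diagonal_dirichlet_kernel[OF x])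
    show "(\<Sum>j<m. v i j * v j k) = (if i = k then real N / 2 else 0)" if "i < m" "k < m" for i k
    proof -
      have "(\<Sum>j<m. v i j * v j k) =
          (\<Sum>l=1..<N. sin (pi * real (Suc i) * real l / real N) * sin (pi * real (Suc k) * real l / real N))"
        unfolding v_def m_def
        by (rule sum.reindex_bij_witness[of _ "\<lambda>l. l - 1" Suc]) (auto simp: mult_ac)
      also have "\<dots> = (if Suc i = Suc k then real N / 2 else 0)"
        by (rule sum_sin_sin) (use that in \<open>auto simp: m_def\<close>)
      finally show ?thesis by simp
    qed
  qed (use False in auto)
  also have "(\<Prod>k<m. \<Sum>i<r. of_int (f i) * dirichlet_kernel i (x k)) =
      (\<Prod>k=1..<N. \<Sum>i<r. of_int (f i) * dirichlet_kernel i (2 * cos (pi * real k / real N)))"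
    unfolding x_def m_def
    by (rule prod.reindex_bij_witness[of _ "\<lambda>l. l - 1" Suc]) auto
  finally show ?thesis .
qed simp

section \<open>Generators of finite fields and their characters\<close>

lemma mult_char_1:
  assumes "mult_char chi" shows "chi 1 = 1"
proof -
  have "chi (1 * 1) = chi 1 * chi 1" "chi 1 \<noteq> 0"
    using assms unfolding mult_char_def by (metis one_neq_zero)+
  then show ?thesis by simp
qed

lemma mult_char_power:
  assumes "mult_char chi" "x \<noteq> 0" shows "chi (x ^ i) = chi x ^ i"
proof (induction i)
  case (Suc i)
  then show ?case using assms by (simp add: mult_char_def)
qed (simp add: mult_char_1[OF assms(1)])

text \<open>Cyclicity only says that every nonzero element is some power of \<open>g\<close>. A
  relation \<open>g ^ r = 1\<close> with \<open>0 < r \<le> q - 1\<close> limits the exponents to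
  \<open>{..<r}\<close>, and counting then forces \<open>r = q - 1\<close>.\<close>

lemma finite_field_generator:
  "\<exists>g :: 'a :: {finite,field}. bij_betw (\<lambda>i. g ^ i) {..<CARD('a) - 1} (UNIV - {0})"
proof -
  define R where "R = (ring_of_type_algebra :: 'a ring)"
  interpret F: field R
    unfolding R_def by (rule field_from_type_algebra)
  have pow: "x [^]\<^bsub>R\<^esub> (i :: nat) = x ^ i" for x i
    by (induction i) (simp_all add: R_def ring_of_type_algebra_def nat_pow_def mult.commute)
  have car: "carrier R = UNIV" "\<zero>\<^bsub>R\<^esub> = 0" and fin: "finite (carrier R)"
    by (simp_all add: R_def ring_of_type_algebra_def)
  from F.finite_field_mult_group_has_gen[OF fin] obtain g where g': "g \<in> carrier (Multiplicative_Group.mult_of R)"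
      "carrier (Multiplicative_Group.mult_of R) = {g [^]\<^bsub>R\<^esub> i | i :: nat. i \<in> UNIV}" ..
  have g: "g \<noteq> 0" using g'(1) by (simp add: car)
  have gen: "UNIV - {0} = {g ^ i | i :: nat. True}" using g'(2) by (simp add: car pow)
  let ?m = "CARD('a) - 1"
  have card: "card (UNIV - {0 :: 'a}) = ?m" by (simp add: card_Diff_singleton)
  have m: "?m > 0" unfolding card[symmetric]
    by (rule card_gt_0_iff[THEN iffD2]) (use g in auto)
  obtain r where r: "r > 0" "r \<le> ?m" "g ^ r = 1"
  proof -
    \<comment> \<open>Pigeonhole: there are \<open>?m + 1\<close> exponents but only
      \<open>?m\<close> nonzero elements.\<close>
    have "\<not> inj_on (\<lambda>i. g ^ i) {..?m}"
    proof
      assume "inj_on (\<lambda>i. g ^ i) {..?m}"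
      then have "card {..?m} \<le> card (UNIV - {0 :: 'a})"
        by (rule card_inj_on_le) (use g in auto)
      then show False using card m by simp
    qed
    then have "\<not> (\<forall>i\<in>{..?m}. \<forall>j\<in>{..?m}. i < j \<longrightarrow> g ^ i \<noteq> g ^ j)"
      by (metis linorder_inj_onI')
    then obtain i j where ij: "i < j" "j \<le> ?m" "g ^ j = g ^ i"
      by auto
    then have "g ^ (j - i) = 1"
      using g by (simp add: power_diff)
    with ij show thesis using that[of "j - i"] by simp
  qed
  have sub: "UNIV - {0} \<subseteq> (\<lambda>i. g ^ i) ` {..<r}"
  proof
    fix x :: 'a assume "x \<in> UNIV - {0}"
    then obtain i where "x = g ^ i" unfolding gen by auto
    also have "\<dots> = g ^ (r * (i div r) + i mod r)" by simp
    also have "\<dots> = g ^ (i mod r)" by (simp only: power_add power_mult r power_one mult_1)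
    finally show "x \<in> (\<lambda>i. g ^ i) ` {..<r}" using r by auto
  qed
  have "?m \<le> card ((\<lambda>i. g ^ i) ` {..<r})"
    using card_mono[OF _ sub] card by simp
  also have "\<dots> \<le> card {..<r}" by (rule card_image_le) simp
  finally have r': "r = ?m" using r by simp
  have eq: "(\<lambda>i. g ^ i) ` {..<?m} = UNIV - {0}"
    using sub g by (auto simp: r')
  have "inj_on (\<lambda>i. g ^ i) {..<?m}"
    by (rule eq_card_imp_inj_on) (simp, simp only: eq card card_lessThan)
  then show ?thesis using eq unfolding bij_betw_def by blast
qed

lemma generator_power_eq_iff:
  fixes g :: "'a :: {finite,field}"
  assumes bij: "bij_betw (\<lambda>i. g ^ i) {..<m} (UNIV - {0})" and m: "m > 1"
  shows "g \<noteq> 0" "g ^ m = 1" "\<And>i j. g ^ i = g ^ j \<longleftrightarrow> i mod m = j mod m"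
proof -
  have "g ^ 1 \<in> UNIV - {0}" using bij m unfolding bij_betw_def by blast
  then show g: "g \<noteq> 0" by simp
  then obtain j where j: "j < m" "g ^ m = g ^ j"
    using bij unfolding bij_betw_def by (metis DiffI UNIV_I imageE lessThan_iff power_not_zero singletonD)
  have inj: "inj_on (\<lambda>i. g ^ i) {..<m}" using bij by (simp add: bij_betw_def)
  \<comment> \<open>Otherwise \<open>m - j\<close> would be a positive exponent below
    \<open>m\<close> with power 1, against injectivity.\<close>
  have "j = 0"
  proof (rule ccontr)
    assume "j \<noteq> 0"
    have "g ^ (m - j) = 1" using j g by (simp add: power_diff)
    then have "m - j = 0"
      using inj_onD[OF inj, of "m - j" 0] \<open>j \<noteq> 0\<close> m by auto
    then show False using j by simp
  qed
  then show gm: "g ^ m = 1" using j by simp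
  have red: "g ^ i = g ^ (i mod m)" for i
  proof -
    have "g ^ i = g ^ (m * (i div m) + i mod m)" by simp
    then show ?thesis by (simp only: power_add power_mult gm power_one mult_1)
  qed
  fix i j
  show "g ^ i = g ^ j \<longleftrightarrow> i mod m = j mod m"
    using inj_onD[OF inj, of "i mod m" "j mod m"] red[of i] red[of j] m by auto
qed

text \<open>For any generator \<open>h\<close> there is a character \<open>psi\<close> sending
  \<open>h\<close> to the primitive root \<open>w\<close>. As \<open>chi\<close> generates,
  \<open>psi\<close> is a power \<open>k\<close> of \<open>chi\<close>, so
  \<open>w = chi (h ^ k)\<close> and \<open>h ^ k\<close> is the desired element.\<close>

lemma ex_normalized_generator:
  fixes chi :: "'a :: {finite,field} \<Rightarrow> complex"
  assumes gen: "char_generator chi" and m: "CARD('a) = m + 1" "m > 1"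
  shows "\<exists>g. bij_betw (\<lambda>i. g ^ i) {..<m} (UNIV - {0}) \<and> chi g = cis (2 * pi / real m)"
proof -
  have chi: "mult_char chi" using gen by (simp add: char_generator_def)
  obtain h :: 'a where h: "bij_betw (\<lambda>i. h ^ i) {..<m} (UNIV - {0})"
    using finite_field_generator[where 'a = 'a] m by auto
  note hm = generator_power_eq_iff[OF h m(2)]
  define w where "w = cis (2 * pi / real m)"
  have wm: "w ^ m = 1" using m by (simp add: w_def DeMoivre)
  have w_pow: "w ^ i = cis (2 * pi * real i / real m)" for i
    by (simp add: w_def DeMoivre mult_ac)
  have w_mod: "w ^ i = w ^ (i mod m)" for i
  proof -
    have "w ^ i = w ^ (m * (i div m) + i mod m)" by simp
    then show ?thesis by (simp only: power_add power_mult wm power_one mult_1)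
  qed
  have w_bij: "bij_betw (\<lambda>i. w ^ i) {..<m} {z. z ^ m = 1}"
    unfolding w_pow by (rule bij_betw_roots_unity) (use m in simp)
  define dlog where "dlog x = the_inv_into {..<m} (\<lambda>i. h ^ i) x" for x
  have dlog: "dlog x < m" "h ^ dlog x = x" if "x \<noteq> 0" for x
  proof -
    show "dlog x < m"
      using the_inv_into_into[of "\<lambda>i. h ^ i" "{..<m}" x "{..<m}"] h that
      unfolding dlog_def bij_betw_def by auto
    show "h ^ dlog x = x"
      using f_the_inv_into_f_bij_betw[OF h, of x] that unfolding dlog_def by simp
  qed
  define psi where "psi x = (if x = 0 then 0 else w ^ dlog x)" for x
  have psi_h: "psi (h ^ i) = w ^ i" for i
  proof -
    have "h ^ dlog (h ^ i) = h ^ i" using hm dlog by simp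
    then have "dlog (h ^ i) mod m = i mod m" using hm(3) by simp
    then show ?thesis using hm w_mod[of i] w_mod[of "dlog (h ^ i)"] by (simp add: psi_def)
  qed
  have "mult_char psi"
    unfolding mult_char_def
  proof (intro conjI allI impI)
    show "psi 0 = 0" by (simp add: psi_def)
    show "psi x \<noteq> 0" if "x \<noteq> 0" for x using that by (simp add: psi_def w_def)
    show "psi (x * y) = psi x * psi y" if "x \<noteq> 0" "y \<noteq> 0" for x y
      using psi_h[of "dlog x + dlog y"] psi_h[of "dlog x"] psi_h[of "dlog y"] that
      by (simp add: power_add dlog)
  qed
  then obtain k :: int where k: "psi = char_power chi k"
    using gen by (auto simp: char_generator_def)
  have "w = psi h" using psi_h[of 1] by simp
  then have k': "w = chi h powi k" using hm by (simp add: k char_power_def)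
  have ch0: "chi h \<noteq> 0" using chi hm by (simp add: mult_char_def)
  have chm: "chi h ^ m = 1"
    using mult_char_power[OF chi hm(1), of m] mult_char_1[OF chi] hm(2) by simp
  \<comment> \<open>The integer exponent is reduced to a natural number so that it can act on
    \<open>h\<close> as an ordinary power.\<close>
  define j where "j = nat (k mod int m)"
  have "chi h powi k = chi h powi (int m * (k div int m) + k mod int m)" by simp
  also have "\<dots> = (chi h ^ m) powi (k div int m) * chi h powi (k mod int m)"
    using ch0 by (simp only: power_int_add power_int_mult power_int_of_nat simp_thms)
  also have "\<dots> = chi h ^ j"
    using m by (simp add: chm j_def power_int_def)
  finally have wj: "w = chi (h ^ j)" using k' hm by (simp add: mult_char_power[OF chi])
  let ?g = "h ^ j"
  \<comment> \<open>Applying \<open>chi\<close> turns powers of \<open>?g\<close> into powers of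
    \<open>w\<close>, which are distinct.\<close>
  have inj: "inj_on (\<lambda>i. ?g ^ i) {..<m}"
  proof (rule inj_onI)
    fix i i' assume i: "i \<in> {..<m}" "i' \<in> {..<m}" "?g ^ i = ?g ^ i'"
    then have "w ^ i = w ^ i'"
      using mult_char_power[OF chi, of ?g] hm(1) by (simp add: wj) (metis power_not_zero)
    then show "i = i'" using w_bij i by (auto simp: bij_betw_def inj_on_def)
  qed
  have "(\<lambda>i. ?g ^ i) ` {..<m} = UNIV - {0}"
    by (rule card_subset_eq) (use hm(1) m inj in \<open>auto simp: card_image card_Diff_singleton\<close>)
  with inj wj show ?thesis unfolding bij_betw_def w_def by metis
qed

section \<open>Jacobi sums and the determinant\<close>

text \<open>Writing \<open>n = 2 * N\<close> encodes that the field order is 1 modulo 4. Fixing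
  \<open>chi g\<close> makes all character sums explicit trigonometric sums in the exponent of
  \<open>g\<close>.\<close>

locale normalized_character =
  fixes g :: "'a :: {finite,field}" and chi :: "'a \<Rightarrow> complex" and n N :: nat
  assumes card_field: "CARD('a) = 2 * n + 1"
    and n: "n = 2 * N" and N_pos: "N > 0"
    and mult_char: "mult_char chi"
    and bij_power: "bij_betw (\<lambda>i. g ^ i) {..<2 * n} (UNIV - {0})"
    and chi_g: "chi g = cis (pi / real n)"
begin

lemma n_pos: "n > 0" "2 * n > 1"
  using n N_pos by auto

lemmas g_facts = generator_power_eq_iff[OF bij_power n_pos(2)]
lemmas g_nonzero [simp] = g_facts(1)

lemma nonzeroE:
  assumes "x \<noteq> 0" obtains i where "i < 2 * n" "x = g ^ i"
  using bij_power assms unfolding bij_betw_def by blast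

lemma chi_power: "chi (g ^ i) = cis (pi * real i / real n)"
  by (simp add: mult_char_power[OF mult_char] chi_g DeMoivre mult_ac)

lemma chi_0 [simp]: "chi 0 = 0" and chi_1 [simp]: "chi 1 = 1"
  and chi_eq_0_iff [simp]: "chi x = 0 \<longleftrightarrow> x = 0"
  using mult_char mult_char_1[OF mult_char] by (auto simp: mult_char_def)

lemma chi_mult: "chi (x * y) = chi x * chi y"
  using mult_char by (cases "x = 0 \<or> y = 0") (auto simp: mult_char_def)

lemma power_card: "x \<noteq> 0 \<Longrightarrow> x ^ (2 * n) = 1" for x :: 'a
  by (elim nonzeroE) (metis g_facts(2) mult.commute power_mult power_one)

lemma even_power_square: "g ^ (2 * i) \<in> squares"
  unfolding squares_def by (auto simp: power_mult[symmetric] mult.commute intro!: exI[of _ "g ^ i"])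

text \<open>On a square \<open>y ^ 2\<close> the right side is \<open>chi (y ^ (2 * n)) = 1\<close>;
  a nonsquare is an odd power \<open>g ^ i\<close>, where it is
  \<open>cis (pi * i) = -1\<close>.\<close>

lemma quad_char_eq: "quad_char x = chi x ^ n" for x :: 'a
proof (cases "x = 0")
  case False
  then obtain i where i: "x = g ^ i" by (rule nonzeroE)
  show ?thesis
  proof (cases "x \<in> squares")
    case True
    then obtain y where y: "x = y ^ 2" by (auto simp: squares_def)
    then have "chi x ^ n = chi (y ^ (2 * n))"
      using False by (simp add: mult_char_power[OF mult_char] power_mult)
    also have "\<dots> = 1" using power_card[of y] y False by auto
    finally show ?thesis using False True by (simp add: quad_char_def)
  next
    case nsq: False
    then have "odd i" using even_power_square i by (metis evenE)
    then obtain j where j: "i = 2 * j + 1" by (rule oddE)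
    have "chi x ^ n = cis (pi * real i)"
      using n_pos by (simp add: i chi_power DeMoivre)
    also have "pi * real i = 2 * pi * real_of_int (int j) + pi" by (simp add: j algebra_simps)
    also have "cis \<dots> = - 1" by (simp only: cis_mult[symmetric] cis_multiple_2pi[OF Ints_of_int]) simp
    finally show ?thesis using False nsq by (simp add: quad_char_def)
  qed
qed (use n_pos in \<open>simp add: quad_char_def\<close>)

lemma quad_char_mult: "quad_char (x * y) = quad_char x * quad_char y" for x y :: 'a
  by (simp add: quad_char_eq chi_mult power_mult_distrib)

lemma quad_char_0 [simp]: "quad_char (0 :: 'a) = 0"
  and quad_char_1 [simp]: "quad_char (1 :: 'a) = 1"
  by (simp_all add: quad_char_eq n_pos)

lemma quad_char_g: "quad_char (g ^ i) = (- 1) ^ i"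
proof -
  have "quad_char (g ^ i) = cis (real i * pi)"
    using n_pos by (simp add: quad_char_eq chi_power DeMoivre mult.commute)
  also have "\<dots> = cis pi ^ i" by (simp only: DeMoivre)
  finally show ?thesis by simp
qed

lemma g_power_n: "g ^ n = - 1"
proof -
  have "(g ^ n)\<^sup>2 = 1" using g_facts(2) by (simp add: mult.commute flip: power_mult)
  moreover have "g ^ n \<noteq> g ^ 0" unfolding g_facts(3) using n_pos by simp
  ultimately show ?thesis by (simp add: power2_eq_1_iff)
qed

text \<open>Since \<open>-1 = g ^ n\<close> and \<open>n\<close> is even, \<open>-1\<close> is a
  square.\<close>

lemma quad_char_minus [simp]: "quad_char (- x) = quad_char x" for x :: 'a
proof -
  have "quad_char (- 1 :: 'a) = 1" using quad_char_g[of n] unfolding g_power_n by (simp add: n)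
  then show ?thesis using quad_char_mult[of "- 1" x] by simp
qed

lemma quad_char_inverse [simp]: "quad_char (inverse x) = quad_char x" for x :: 'a
proof (cases "x = 0")
  case False
  then have "quad_char (inverse x) * quad_char x = 1"
    by (simp flip: quad_char_mult)
  then show ?thesis by (auto simp: quad_char_def split: if_splits)
qed simp

abbreviation nonzero_squares :: "'a set" where "nonzero_squares \<equiv> squares - {0}"
abbreviation nonsquares :: "'a set" where "nonsquares \<equiv> - squares"

lemma zero_square [simp]: "(0 :: 'a) \<in> squares"
  unfolding squares_def by (auto intro!: exI[of _ 0])

lemma quad_char_nonzero_square: "x \<in> nonzero_squares \<Longrightarrow> quad_char x = 1"
  and quad_char_nonsquare: "x \<in> nonsquares \<Longrightarrow> quad_char x = - 1"
  and nonzero_squares_iff: "x \<in> nonzero_squares \<longleftrightarrow> quad_char x = 1"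
  and nonsquares_iff: "x \<in> nonsquares \<longleftrightarrow> quad_char x = - 1"
  by (auto simp: quad_char_def)

lemma g_power_square_iff: "g ^ i \<in> squares \<longleftrightarrow> even i"
  using nonsquares_iff[of "g ^ i"] by (cases "even i") (auto simp: quad_char_g)

lemma bij_nonzero_squares: "bij_betw (\<lambda>i. g ^ (2 * i)) {..<n} nonzero_squares"
proof (rule bij_betw_imageI)
  show "inj_on (\<lambda>i. g ^ (2 * i)) {..<n}" by (auto simp: inj_on_def g_facts(3))
  show "(\<lambda>i. g ^ (2 * i)) ` {..<n} = nonzero_squares"
  proof (intro equalityI subsetI)
    fix x assume "x \<in> nonzero_squares"
    moreover then obtain i where i: "i < 2 * n" "x = g ^ i" by (auto elim: nonzeroE)
    ultimately have "even i" by (simp add: g_power_square_iff)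
    then show "x \<in> (\<lambda>i. g ^ (2 * i)) ` {..<n}" using i by (auto elim!: evenE)
  qed (auto simp: g_power_square_iff)
qed

lemma bij_nonsquares: "bij_betw (\<lambda>i. g ^ (2 * i + 1)) {..<n} nonsquares"
proof (rule bij_betw_imageI)
  show "inj_on (\<lambda>i. g ^ (2 * i + 1)) {..<n}" unfolding inj_on_def g_facts(3) by auto
  show "(\<lambda>i. g ^ (2 * i + 1)) ` {..<n} = nonsquares"
  proof (intro equalityI subsetI)
    fix x assume x: "x \<in> nonsquares"
    then have "x \<noteq> 0" by auto
    then obtain i where i: "i < 2 * n" "x = g ^ i" by (rule nonzeroE)
    with x have "odd i" by (simp add: g_power_square_iff)
    then obtain j where "i = 2 * j + 1" by (rule oddE)
    then show "x \<in> (\<lambda>i. g ^ (2 * i + 1)) ` {..<n}" using i by (intro image_eqI[of _ _ j]) auto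
  next
    fix x assume "x \<in> (\<lambda>i. g ^ (2 * i + 1)) ` {..<n}"
    then obtain i where "x = g ^ (2 * i + 1)" by auto
    then show "x \<in> nonsquares" using g_power_square_iff[of "2 * i + 1"] by simp
  qed
qed

lemma sum_nonzero:
  "(\<Sum>x\<in>UNIV - {0}. F x) = (\<Sum>x\<in>nonzero_squares. F x) + (\<Sum>x\<in>nonsquares. F x)"
  for F :: "'a \<Rightarrow> complex"
proof -
  have "UNIV - {0} = nonzero_squares \<union> nonsquares" by auto
  then show ?thesis by (simp only:, subst sum.union_disjoint) auto
qed

text \<open>The exponents \<open>i\<close> and \<open>n + i\<close> give the same square, because
  \<open>g ^ (2 * n) = 1\<close>.\<close>

lemma sum_over_squares:
  "(\<Sum>x\<in>UNIV - {0}. F (x\<^sup>2)) = 2 * (\<Sum>x\<in>nonzero_squares. F x)" for F :: "'a \<Rightarrow> complex"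
proof -
  have "(\<Sum>x\<in>UNIV - {0}. F (x\<^sup>2)) = (\<Sum>i<2*n. F (g ^ (2 * i)))"
    by (subst sum.reindex_bij_betw[OF bij_power, symmetric]) (simp add: mult.commute flip: power_mult)
  also have "{..<2*n} = {..<n} \<union> {n..<2*n}" by auto
  also have "(\<Sum>i\<in>\<dots>. F (g ^ (2 * i))) =
      (\<Sum>i<n. F (g ^ (2 * i))) + (\<Sum>i\<in>{n..<2*n}. F (g ^ (2 * i)))"
    by (subst sum.union_disjoint) auto
  also have "(\<Sum>i\<in>{n..<2*n}. F (g ^ (2 * i))) = (\<Sum>i<n. F (g ^ (2 * (n + i))))"
    by (rule sum.reindex_bij_witness[of _ "\<lambda>i. n + i" "\<lambda>i. i - n"]) auto
  also have "(\<lambda>i. F (g ^ (2 * (n + i)))) = (\<lambda>i. F (g ^ (2 * i)))"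
    using g_facts(2) by (simp add: power_add distrib_left)
  finally show ?thesis
    by (simp add: sum.reindex_bij_betw[OF bij_nonzero_squares])
qed

abbreviation ch :: "int \<Rightarrow> 'a \<Rightarrow> complex" where "ch \<equiv> char_power chi"

lemma ch_mult: "ch k (x * y) = ch k x * ch k y"
  by (simp add: char_power_def chi_mult power_int_mult_distrib)

lemma ch_0 [simp]: "ch k 0 = 0"
  and ch_1 [simp]: "ch k 1 = 1"
  by (simp_all add: char_power_def)

lemma ch_nonzero: "x \<noteq> 0 \<Longrightarrow> ch k x \<noteq> 0"
  by (simp add: char_power_def)

lemma ch_add: "ch (k + l) x = ch k x * ch l x"
  by (simp add: char_power_def power_int_add)

lemma ch_minus: "ch (- k) x = inverse (ch k x)"
  by (simp add: char_power_def power_int_minus)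

lemma ch_inverse: "ch k (inverse x) = ch (- k) x"
proof (cases "x = 0")
  case False
  then have "ch k (inverse x) * ch k x = 1" by (simp flip: ch_mult)
  then show ?thesis by (metis ch_minus inverse_unique mult.commute)
qed simp

lemma ch_n: "ch (int n) x = quad_char x"
  by (simp add: char_power_def quad_char_eq n_pos)

lemma ch_of_square: "ch (int N) (x\<^sup>2) = quad_char x"
  by (simp add: power2_eq_square ch_mult ch_n flip: ch_add)
     (simp add: n flip: ch_n)

lemma ch_g: "ch (int k) (g ^ i) = cis (pi * real k * real i / real n)"
  by (simp add: char_power_def chi_power DeMoivre mult_ac)

section \<open>Differences of Jacobi sums\<close>

definition jacobi_diff :: "int \<Rightarrow> complex" where
  "jacobi_diff k = jacobi_sum quad_char (ch k) - jacobi_sum quad_char (ch (- k))"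

lemma jacobi_diff_minus: "jacobi_diff (- k) = - jacobi_diff k"
  by (simp add: jacobi_diff_def)

text \<open>After inverting \<open>u\<close> in the second sum,
  \<open>\<phi>(1 - 1/u) = \<phi>(u) \<phi>(1 - u)\<close>, so the difference carries the weight
  \<open>1 - \<phi>(u)\<close>: 0 on nonzero squares and 2 on nonsquares.\<close>

lemma jacobi_diff_eq: "jacobi_diff k = 2 * (\<Sum>u\<in>nonsquares. quad_char (1 - u) * ch k u)"
proof -
  have J: "jacobi_sum quad_char (ch l) = (\<Sum>u\<in>UNIV - {0}. quad_char (1 - u) * ch l u)" for l
  proof -
    have "jacobi_sum quad_char (ch l) = (\<Sum>u\<in>UNIV. quad_char (1 - u) * ch l u)"
      unfolding jacobi_sum_def
      by (rule sum.reindex_bij_witness[of _ "\<lambda>u. 1 - u" "\<lambda>u. 1 - u"]) auto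
    also have "\<dots> = (\<Sum>u\<in>UNIV - {0}. quad_char (1 - u) * ch l u)"
      by (rule sum.mono_neutral_right) auto
    finally show ?thesis .
  qed
  have "jacobi_sum quad_char (ch (- k)) =
      (\<Sum>u\<in>UNIV - {0}. quad_char (1 - inverse u) * ch k u)"
    unfolding J
    by (rule sum.reindex_bij_witness[of _ inverse inverse]) (auto simp: ch_inverse)
  also have "\<dots> = (\<Sum>u\<in>UNIV - {0}. quad_char (1 - u) * ch k u * quad_char u)"
  proof (rule sum.cong[OF refl])
    fix u :: 'a assume "u \<in> UNIV - {0}"
    then have "1 - inverse u = - (inverse u * (1 - u))" by (simp add: field_simps)
    then have "quad_char (1 - inverse u) = quad_char u * quad_char (1 - u)"
      by (simp only: quad_char_minus quad_char_mult quad_char_inverse)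
    then show "quad_char (1 - inverse u) * ch k u = quad_char (1 - u) * ch k u * quad_char u"
      by simp
  qed
  finally have "jacobi_diff k = (\<Sum>u\<in>UNIV - {0}. quad_char (1 - u) * ch k u * (1 - quad_char u))"
    unfolding jacobi_diff_def J by (simp add: sum_subtractf algebra_simps)
  also have "\<dots> = (\<Sum>u\<in>nonsquares. quad_char (1 - u) * ch k u * 2)"
    unfolding sum_nonzero by (simp add: quad_char_nonzero_square quad_char_nonsquare)
  finally show ?thesis by (simp add: sum_distrib_left mult_ac)
qed

text \<open>The eigenvalues of the group circulant \<open>[\<phi>(s\<^sub>i + d s\<^sub>j)]\<close>, \<open>i, j \<ge> 1\<close>.\<close>

definition mu :: "'a \<Rightarrow> int \<Rightarrow> complex" where
  "mu d k = (\<Sum>t\<in>nonzero_squares. quad_char (1 + d * t) * ch k t)"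

text \<open>As \<open>-1\<close> is a square and \<open>d\<close> is not,
  \<open>t \<mapsto> - d * t\<close> maps the nonzero squares onto the nonsquares.\<close>

lemma mu_eq:
  assumes d: "d \<in> nonsquares"
  shows "mu d k = ch (- k) (- d) * jacobi_diff k / 2"
proof -
  have d0: "d \<noteq> 0" using d by auto
  have qd: "quad_char d = - 1" using d by (simp only: nonsquares_iff)
  have "(\<Sum>u\<in>nonsquares. quad_char (1 - u) * ch k u) =
      (\<Sum>t\<in>nonzero_squares. quad_char (1 - (- d * t)) * ch k (- d * t))"
  proof (rule sum.reindex_bij_witness[of _ "\<lambda>t. - d * t" "\<lambda>u. - (inverse d * u)"])
    fix u assume "u \<in> nonsquares"
    then show "- d * - (inverse d * u) = u" "- (inverse d * u) \<in> nonzero_squares"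
      "quad_char (1 - (- d * - (inverse d * u))) * ch k (- d * - (inverse d * u)) =
        quad_char (1 - u) * ch k u"
      unfolding nonsquares_iff nonzero_squares_iff
      using d0 by (simp_all add: quad_char_mult qd flip: mult.assoc)
  next
    fix t assume "t \<in> nonzero_squares"
    then show "- (inverse d * (- d * t)) = t" "- d * t \<in> nonsquares"
      unfolding nonsquares_iff nonzero_squares_iff
      using d0 by (simp_all add: quad_char_mult qd flip: mult.assoc)
  qed
  also have "\<dots> = ch k (- d) * mu d k"
    by (simp only: ch_mult mu_def sum_distrib_left) (simp add: mult_ac)
  finally have "jacobi_diff k = 2 * (ch k (- d) * mu d k)" unfolding jacobi_diff_eq by simp
  then show ?thesis using d0 ch_nonzero[of "- d" k] by (simp add: ch_minus field_simps)
qed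

text \<open>The quadratic character is its own inverse.\<close>

lemma jacobi_diff_n: "jacobi_diff (int n) = 0"
proof -
  have "ch (- int n) = ch (int n)"
    by (rule ext) (auto simp: ch_minus ch_n quad_char_def)
  then show ?thesis by (simp add: jacobi_diff_def)
qed

section \<open>Trigonometric form of the differences and integrality\<close>

definition coeff_sign :: "nat \<Rightarrow> int" where
  "coeff_sign i = (let u = 1 - g ^ (2 * i + 1) in if u = 0 then 0 else if u \<in> squares then 1 else - 1)"

lemma of_int_coeff_sign: "of_int (coeff_sign i) = quad_char (1 - g ^ (2 * i + 1))"
  by (simp add: coeff_sign_def quad_char_def Let_def)

text \<open>The two odd exponents add up to \<open>2 * n\<close>, so the powers are inverse to each
  other. The sign is the value of the quadratic character at the nonsquare
  \<open>g ^ (2 * i + 1)\<close>.\<close>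

lemma quad_char_reflect:
  assumes "i < n"
  shows "quad_char (1 - g ^ (2 * (n - 1 - i) + 1)) = - quad_char (1 - g ^ (2 * i + 1))"
proof -
  let ?x = "g ^ (2 * i + 1)"
  have "(2 * i + 1) + (2 * (n - 1 - i) + 1) = 2 * n" using assms by simp
  then have "?x * g ^ (2 * (n - 1 - i) + 1) = 1" by (simp only: power_add[symmetric] g_facts(2))
  then have "g ^ (2 * (n - 1 - i) + 1) = inverse ?x" by (metis inverse_unique)
  moreover have "1 - inverse ?x = - (inverse ?x * (1 - ?x))" by (simp add: field_simps)
  moreover have "quad_char ?x = - 1" by (simp only: quad_char_g) simp
  ultimately show ?thesis by (simp only: quad_char_minus quad_char_mult quad_char_inverse) simp
qed

text \<open>One integer polynomial, independent of \<open>k\<close>, evaluated at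
  \<open>2 * cos (pi * k / N)\<close>. Indices below \<open>N\<close> suffice because the other half
  is determined by reflection.\<close>

definition cos_poly :: "nat \<Rightarrow> real" where
  "cos_poly k = (\<Sum>i<N. of_int (coeff_sign i) * dirichlet_kernel i (2 * cos (pi * real k / real N)))"

lemma jacobi_diff_eq_sin: "jacobi_diff (int k) = 2 * \<i> * of_real (2 * sin (pi * real k / real (2 * N)) * cos_poly k)"
proof -
  define e where "e i = quad_char (1 - g ^ (2 * i + 1))" for i
  define th where "th = pi * real k / real (2 * N)"
  have ch: "ch (int k) (g ^ (2 * i + 1)) = cis (real (2 * i + 1) * th)" for i
    unfolding ch_g by (simp add: th_def n algebra_simps)
  have "jacobi_diff (int k) = 2 * (\<Sum>i<n. e i * cis (real (2 * i + 1) * th))"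
    unfolding jacobi_diff_eq ch[symmetric] e_def
    by (simp only: sum.reindex_bij_betw[OF bij_nonsquares, symmetric])
  also have "{..<n} = {..<N} \<union> {N..<n}" using n by auto
  also have "(\<Sum>i\<in>\<dots>. e i * cis (real (2 * i + 1) * th)) =
      (\<Sum>i<N. e i * cis (real (2 * i + 1) * th)) + (\<Sum>i\<in>{N..<n}. e i * cis (real (2 * i + 1) * th))"
    by (subst sum.union_disjoint) auto
  also have "(\<Sum>i\<in>{N..<n}. e i * cis (real (2 * i + 1) * th)) =
      (\<Sum>i<N. e (n - 1 - i) * cis (real (2 * (n - 1 - i) + 1) * th))"
    by (rule sum.reindex_bij_witness[of _ "\<lambda>i. n - 1 - i" "\<lambda>i. n - 1 - i"]) (use n in auto)
  \<comment> \<open>Pair \<open>i\<close> with \<open>n - 1 - i\<close>: the coefficient changes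
    sign and, since \<open>2 * n * th = 2 * pi * k\<close>, the angle changes sign modulo full
    turns. Each pair becomes a sine.\<close>
  also have "(\<Sum>i<N. e i * cis (real (2 * i + 1) * th)) + \<dots> =
      (\<Sum>i<N. of_int (coeff_sign i) * (2 * \<i> * of_real (sin (real (2 * i + 1) * th))))"
    unfolding sum.distrib[symmetric]
  proof (rule sum.cong[OF refl])
    fix i assume "i \<in> {..<N}"
    then have i: "i < n" using n by simp
    have "real (2 * (n - 1 - i) + 1) = 2 * real n - real (2 * i + 1)"
      using i by (simp add: of_nat_diff)
    then have "real (2 * (n - 1 - i) + 1) * th = 2 * real n * th - real (2 * i + 1) * th"
      by (simp only: left_diff_distrib)
    also have "2 * real n * th = 2 * pi * real_of_int (int k)"
      using N_pos by (simp add: th_def n)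
    also have "cis (2 * pi * real_of_int (int k) - real (2 * i + 1) * th) =
        cis (- (real (2 * i + 1) * th))"
      by (simp only: diff_conv_add_uminus cis_mult[symmetric] cis_multiple_2pi[OF Ints_of_int] mult_1)
    finally have eq: "e (n - 1 - i) * cis (real (2 * (n - 1 - i) + 1) * th) =
        - e i * cis (- (real (2 * i + 1) * th))"
      by (simp only: e_def quad_char_reflect[OF i])
    have "e i * cis (real (2 * i + 1) * th) +
        e (n - 1 - i) * cis (real (2 * (n - 1 - i) + 1) * th) =
        e i * (cis (real (2 * i + 1) * th) - cis (- (real (2 * i + 1) * th)))"
      by (simp only: eq right_diff_distrib) simp
    also have "cis (real (2 * i + 1) * th) - cis (- (real (2 * i + 1) * th)) =
        2 * \<i> * of_real (sin (real (2 * i + 1) * th))"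
      by (simp add: complex_eq_iff)
    finally show "e i * cis (real (2 * i + 1) * th) +
        e (n - 1 - i) * cis (real (2 * (n - 1 - i) + 1) * th) =
        of_int (coeff_sign i) * (2 * \<i> * of_real (sin (real (2 * i + 1) * th)))"
      by (simp only: of_int_coeff_sign e_def)
  qed
  also have "\<dots> = 2 * \<i> * of_real (sin th * cos_poly k)"
  proof -
    have "2 * cos (2 * th) = 2 * cos (pi * real k / real N)" by (simp add: th_def)
    then show ?thesis
      unfolding cos_poly_def sin_odd_multiple by (simp add: sum_distrib_left mult_ac)
  qed
  finally show ?thesis by (simp add: th_def mult_ac)
qed

lemma I_prod_eq: "I_prod n chi = (\<Prod>k=1..<N. jacobi_diff (int k))"
  unfolding I_prod_def jacobi_diff_def[symmetric]
  by (rule prod.reindex_bij_witness[of _ int nat]) (auto simp: n)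

lemma card_minus_1: "real CARD('a) - 1 = 2 * real n"
  by (simp add: card_field)

text \<open>The sine product \<open>sqrt N\<close> meets \<open>sqrt (q - 1) = 2 * sqrt N\<close>,
  giving \<open>2 * N\<close>; the \<open>N - 1\<close> factors \<open>2 * \<i>\<close> combine with
  the power of \<open>\<i>\<close> in \<open>y_val\<close> to \<open>(-2) ^ (N - 1)\<close>.\<close>

lemma y_val_Ints: "y_val n chi \<in> \<int>"
proof -
  let ?s = "\<lambda>k. 2 * sin (pi * real k / real (2 * N))"
  have "I_prod n chi = (\<Prod>k=1..<N. (2 * \<i>) * of_real (?s k) * of_real (cos_poly k))"
    unfolding I_prod_eq jacobi_diff_eq_sin by (simp only: of_real_mult mult.assoc)
  also have "\<dots> = (2 * \<i>) ^ (N - 1) * of_real (\<Prod>k=1..<N. ?s k) * of_real (\<Prod>k=1..<N. cos_poly k)"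
    by (simp only: of_real_prod, simp only: prod.distrib prod_constant card_atLeastLessThan power_mult_distrib)
  also have "(\<Prod>k=1..<N. ?s k) = sqrt (real N)"
    by (rule prod_sin_half[OF N_pos])
  finally have I: "I_prod n chi = (2 * \<i>) ^ (N - 1) * of_real (sqrt (real N)) * of_real (\<Prod>k=1..<N. cos_poly k)" .
  have e: "(n - 2) div 2 = N - 1" using n by simp
  have "sqrt (real CARD('a) - 1) = sqrt (2\<^sup>2 * real N)" by (simp add: card_minus_1 n)
  also have "\<dots> = 2 * sqrt (real N)" by (simp only: real_sqrt_mult real_sqrt_abs)
  finally have s: "sqrt (real CARD('a) - 1) = 2 * sqrt (real N)" .
  have "y_val n chi = (\<i> ^ (N - 1) * (2 * \<i>) ^ (N - 1)) *
      of_real (2 * (sqrt (real N) * sqrt (real N))) * of_real (\<Prod>k=1..<N. cos_poly k)"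
    unfolding y_val_def I e s by (simp only: of_real_mult of_real_numeral mult_ac)
  moreover have "\<i> ^ (N - 1) * (2 * \<i>) ^ (N - 1) = (- 2) ^ (N - 1)"
    unfolding power_mult_distrib[symmetric] by (rule arg_cong2[where f = power]) simp_all
  moreover have "2 * (sqrt (real N) * sqrt (real N)) = real (2 * N)" by simp
  ultimately have y: "y_val n chi = (- 2) ^ (N - 1) * of_real (real (2 * N)) * of_real (\<Prod>k=1..<N. cos_poly k)"
    by (simp only:)
  have "(\<Prod>k=1..<N. cos_poly k) \<in> \<int>"
    unfolding cos_poly_def by (rule prod_dirichlet_combination_Ints)
  then obtain z where "(\<Prod>k=1..<N. cos_poly k) = of_int z" by (elim Ints_cases)
  then show ?thesis unfolding y by simp
qed

section \<open>Spectrum and determinant of the bordered circulant\<close>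

lemma ch_n_square: "t \<in> nonzero_squares \<Longrightarrow> ch (int n) t = 1"
  by (simp only: ch_n quad_char_nonzero_square)

text \<open>Orthogonality on the cyclic group of nonzero squares, on which \<open>chi\<close> has
  order \<open>n\<close>: the sum is geometric in an \<open>n\<close>-th root of unity.\<close>

lemma sum_ch_nonzero_squares:
  "(\<Sum>t\<in>nonzero_squares. ch k t) = (if int n dvd k then of_nat n else 0)"
proof -
  define w where "w = cis (2 * pi * real_of_int k / real n)"
  have w: "ch k (g ^ (2 * i)) = w ^ i" for i
    by (simp add: char_power_def chi_power w_def DeMoivre cis_power_int mult_ac)
  have wn: "w ^ n = 1"
  proof -
    have "real n * (2 * pi * real_of_int k / real n) = 2 * pi * real_of_int k" using n_pos by simp
    then show ?thesis by (simp only: w_def DeMoivre cis_multiple_2pi[OF Ints_of_int])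
  qed
  have "(\<Sum>t\<in>nonzero_squares. ch k t) = (\<Sum>i<n. w ^ i)"
    by (simp only: sum.reindex_bij_betw[OF bij_nonzero_squares, symmetric] w)
  also have "\<dots> = (if w = 1 then of_nat n else 0)"
    using wn by (simp add: sum_gp_strict)
  finally show ?thesis using n_pos by (simp only: w_def cis_eq_1_iff_dvd)
qed

text \<open>Substitute \<open>u = x * t\<close> and use that the square \<open>x\<close> has
  quadratic character 1; thus characters are eigenvectors of the circulant.\<close>

lemma mu_row:
  assumes x: "x \<in> nonzero_squares"
  shows "(\<Sum>u\<in>nonzero_squares. quad_char (x + d * u) * ch k u) = ch k x * mu d k"
proof -
  have x0: "x \<noteq> 0" and qx: "quad_char x = 1" using x quad_char_nonzero_square by auto
  have "(\<Sum>u\<in>nonzero_squares. quad_char (x + d * u) * ch k u) =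
      (\<Sum>t\<in>nonzero_squares. quad_char (x * (1 + d * t)) * ch k (x * t))"
  proof (rule sum.reindex_bij_witness[of _ "\<lambda>t. x * t" "\<lambda>u. inverse x * u"])
    fix u assume "u \<in> nonzero_squares"
    then show "x * (inverse x * u) = u" "inverse x * u \<in> nonzero_squares"
      "quad_char (x * (1 + d * (inverse x * u))) * ch k (x * (inverse x * u)) =
        quad_char (x + d * u) * ch k u"
      unfolding nonzero_squares_iff
      using x0 by (simp_all add: quad_char_mult[of "inverse x"] qx distrib_left) (simp add: field_simps)
  next
    fix t assume "t \<in> nonzero_squares"
    then show "inverse x * (x * t) = t" "x * t \<in> nonzero_squares"
      unfolding nonzero_squares_iff
      using x0 by (simp_all add: quad_char_mult[of x] qx)
  qed
  then show ?thesis by (simp add: quad_char_mult qx ch_mult mu_def sum_distrib_left mult_ac)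
qed

lemma mu_0:
  assumes "d \<in> nonsquares" shows "mu d 0 = 0" "mu d (int n) = 0"
  unfolding mu_eq[OF assms] by (simp_all add: jacobi_diff_n, simp add: jacobi_diff_def)

text \<open>For \<open>0 < k < n\<close> the character, extended by 0 at index 0, sums to 0 over the
  nonzero squares and so is not affected by the border. On the remaining plane the matrix squares to
  \<open>-n\<close>, because \<open>mu d 0 = 0\<close>; its two eigenvalues there have product
  \<open>n\<close>.\<close>

lemma det_T_mat:
  assumes s: "bij_betw s {0..n} squares" "s 0 = 0" and d: "d \<in> nonsquares"
  shows "Determinant.det (T_mat n s d) = of_nat n * (\<Prod>k=1..<n. mu d (int k))"
proof -
  have qd: "quad_char d = - 1" using d by (simp only: nonsquares_iff)
  have bij: "bij_betw s {1..n} nonzero_squares"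
  proof -
    have "bij_betw s ({0..n} - {0}) (squares - {s 0})"
      by (rule bij_betw_DiffI) (use s in \<open>auto simp: bij_betw_def\<close>)
    moreover have "{0..n} - {0} = {1..n}" by auto
    ultimately show ?thesis by (simp add: s)
  qed
  have s_in: "s j \<in> nonzero_squares" if "0 < j" "j < n + 1" for j
    using bij_betwE[OF bij] that by auto
  have sum_s: "(\<Sum>j<n + 1. G j) = G 0 + (\<Sum>t\<in>nonzero_squares. F t)"
    if "\<And>j. 0 < j \<Longrightarrow> j < n + 1 \<Longrightarrow> G j = F (s j)" for G :: "nat \<Rightarrow> complex" and F
  proof -
    have "{..<n + 1} = insert 0 {1..n}" by auto
    then have "(\<Sum>j<n + 1. G j) = G 0 + (\<Sum>j\<in>{1..n}. G j)" by simp
    also have "(\<Sum>j\<in>{1..n}. G j) = (\<Sum>j\<in>{1..n}. F (s j))"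
      by (rule sum.cong) (auto simp: that)
    finally show ?thesis by (simp only: sum.reindex_bij_betw[OF bij])
  qed
  define r where "r = \<i> * of_real (sqrt (real n))"
  have r2: "r * r = - of_nat n"
  proof -
    have "r * r = (\<i> * \<i>) * of_real (sqrt (real n) * sqrt (real n))"
      unfolding r_def of_real_mult by (simp only: mult_ac)
    then show ?thesis by simp
  qed
  \<comment> \<open>The columns \<open>0\<close> and \<open>n\<close> of \<open>v\<close> diagonalise \<open>T\<close> on the plane spanned by the first unit vector
    and the indicator of the other coordinates; \<open>x\<close> is the conjugate transpose of \<open>v\<close>.\<close>
  define al where "al k = (if k = 0 then r else if k = n then - r else 0)" for k :: nat
  define lam where "lam k = (if k = 0 then r else if k = n then - r else mu d (int k))" for k :: nat
  define v where "v j k = (if j = 0 then al k else ch (int k) (s j))" for j k :: nat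
  define x where "x i j = (if j = 0 then - al i else ch (- int i) (s j))" for i j :: nat
  \<comment> \<open>Columns 0 and \<open>n\<close> carry the same character on squares: the border
    entry doubles their norm, and it also cancels their mutual product.\<close>
  define c where "c k = (if k = 0 \<or> k = n then 2 * of_nat n else of_nat n :: complex)" for k :: nat
  have dvd: "int n dvd int k \<longleftrightarrow> k = 0 \<or> k = n" if "k < n + 1" for k
    using that by (auto dest: dvd_imp_le)
  have "Determinant.det (mat (n + 1) (n + 1) (\<lambda>(i, j). quad_char (s i + d * s j))) = (\<Prod>k<n + 1. lam k)"
  proof (rule det_eq_prod_eigenvalues[where v = v and x = x and c = c])
    fix i k assume i: "i < n + 1" and k: "k < n + 1"
    show "(\<Sum>j<n + 1. quad_char (s i + d * s j) * v j k) = lam k * v i k"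
    proof (cases "i = 0")
      case True
      have "(\<Sum>j<n + 1. quad_char (s i + d * s j) * v j k) =
          quad_char (s i + d * s 0) * v 0 k + (\<Sum>t\<in>nonzero_squares. - ch (int k) t)"
        by (rule sum_s) (use s_in in \<open>simp add: True s qd v_def quad_char_mult quad_char_nonzero_square\<close>)
      also have "\<dots> = - (if k = 0 \<or> k = n then of_nat n else 0)"
        by (simp only: sum_negf sum_ch_nonzero_squares dvd[OF k]) (simp add: True s)
      also have "\<dots> = lam k * v i k"
        using r2 n_pos by (simp add: True v_def lam_def al_def)
      finally show ?thesis .
    next
      case False
      then have si: "s i \<in> nonzero_squares" using s_in i by simp
      have "(\<Sum>j<n + 1. quad_char (s i + d * s j) * v j k) =
          quad_char (s i + d * s 0) * v 0 k +
          (\<Sum>t\<in>nonzero_squares. quad_char (s i + d * t) * ch (int k) t)"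
        by (rule sum_s) (simp add: v_def)
      also have "\<dots> = al k + ch (int k) (s i) * mu d (int k)"
        unfolding mu_row[OF si] using quad_char_nonzero_square[OF si] by (simp add: s v_def)
      also have "\<dots> = lam k * v i k"
        using False mu_0[OF d] ch_n_square[OF si] si n_pos
        by (auto simp: v_def lam_def al_def char_power_def[of _ 0])
      finally show ?thesis .
    qed
    show "(\<Sum>j<n + 1. x i j * v j k) = (if i = k then c i else 0)"
    proof -
      have "(\<Sum>j<n + 1. x i j * v j k) = x i 0 * v 0 k + (\<Sum>t\<in>nonzero_squares. ch (- int i + int k) t)"
        by (rule sum_s) (simp add: x_def v_def flip: ch_add)
      also have "\<dots> = - al i * al k + (if int n dvd (int k - int i) then of_nat n else 0)"
        by (simp add: sum_ch_nonzero_squares x_def v_def)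
      also have "int n dvd (int k - int i) \<longleftrightarrow> k = i \<or> (k = 0 \<and> i = n) \<or> (k = n \<and> i = 0)"
      proof
        assume *: "int n dvd (int k - int i)"
        show "k = i \<or> (k = 0 \<and> i = n) \<or> (k = n \<and> i = 0)"
        proof (rule ccontr)
          assume "\<not> ?thesis"
          then have "\<bar>int k - int i\<bar> < int n" "int k - int i \<noteq> 0" using i k by auto
          with * show False using dvd_imp_le_int[of "int k - int i" "int n"] by simp
        qed
      qed auto
      also have "- al i * al k + (if k = i \<or> (k = 0 \<and> i = n) \<or> (k = n \<and> i = 0) then of_nat n else 0) =
          (if i = k then c i else 0)"
        using r2 n_pos by (auto simp: al_def c_def)
      finally show ?thesis .
    qed
  next
    fix k assume "k < n + 1"
    then show "c k \<noteq> 0" using n_pos by (simp add: c_def)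
  qed
  also have "{..<n + 1} = insert 0 (insert n {1..<n})" using n_pos by auto
  also have "prod lam \<dots> = lam 0 * (lam n * prod lam {1..<n})"
    using n_pos by (subst prod.insert, simp, simp, subst prod.insert) auto
  also have "\<dots> = of_nat n * (\<Prod>k=1..<n. lam k)"
    using r2 n_pos by (simp add: lam_def flip: mult.assoc)
  also have "(\<Prod>k=1..<n. lam k) = (\<Prod>k=1..<n. mu d (int k))"
    by (rule prod.cong) (auto simp: lam_def)
  finally show ?thesis by (simp add: T_mat_def)
qed

text \<open>Exponents differing by \<open>n\<close> define the same character on the
  squares.\<close>

lemma mu_reflect:
  assumes "k \<le> n" shows "mu d (- int (n - k)) = mu d (int k)"
proof -
  have "ch (- int (n - k)) t = ch (int k) t" if "t \<in> nonzero_squares" for t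
    using ch_add[of "int n" "- int (n - k)" t] ch_n_square[OF that] assms by (simp add: of_nat_diff)
  then show ?thesis unfolding mu_def by (intro sum.cong) auto
qed

text \<open>Pair \<open>k\<close> with \<open>n - k\<close>, whose eigenvalue is that of
  \<open>-k\<close>; only \<open>k = N\<close> stays unpaired. In each pair the character values at
  \<open>-d\<close> cancel and \<open>jacobi_diff\<close> is odd, which leaves \<open>-1/4\<close>
  times a square.\<close>

lemma prod_mu:
  assumes d: "d \<in> nonsquares"
  shows "(\<Prod>k=1..<n. mu d (int k)) = mu d (int N) * (- 1 / 4) ^ (N - 1) * (I_prod n chi)\<^sup>2"
proof -
  let ?m = "\<lambda>k. mu d (int k)"
  have d0: "- d \<noteq> 0" using d by auto
  have "{1..<n} = insert N ({1..<N} \<union> {N<..<n})" using n N_pos by auto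
  then have "prod ?m {1..<n} = ?m N * (prod ?m {1..<N} * prod ?m {N<..<n})"
    by (simp only:, subst prod.insert, simp, simp, subst prod.union_disjoint) auto
  also have "prod ?m {N<..<n} = (\<Prod>k\<in>{N<..<n}. mu d (- int (n - k)))"
    by (rule prod.cong[OF refl], rule mu_reflect[symmetric]) simp
  also have "\<dots> = (\<Prod>k=1..<N. mu d (- int k))"
    by (rule prod.reindex_bij_witness[of _ "\<lambda>k. n - k" "\<lambda>k. n - k"])
       (use n in auto)
  also have "prod ?m {1..<N} * \<dots> = (\<Prod>k=1..<N. (- 1 / 4) * (jacobi_diff (int k))\<^sup>2)"
    unfolding prod.distrib[symmetric]
  proof (rule prod.cong[OF refl])
    fix k
    have "ch (- int k) (- d) * ch (int k) (- d) = 1"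
      using ch_nonzero[OF d0] by (simp add: ch_minus)
    then have "mu d (int k) * mu d (- int k) = jacobi_diff (int k) * jacobi_diff (- int k) / 4"
      unfolding mu_eq[OF d] by (simp add: field_simps)
    then show "mu d (int k) * mu d (- int k) = (- 1 / 4) * (jacobi_diff (int k))\<^sup>2"
      by (simp add: jacobi_diff_minus power2_eq_square)
  qed
  also have "\<dots> = (- 1 / 4) ^ (N - 1) * (I_prod n chi)\<^sup>2"
    unfolding I_prod_eq by (simp only: prod.distrib prod_constant card_atLeastLessThan prod_power_distrib)
  finally show ?thesis by (simp add: mult_ac)
qed

section \<open>Point counts and the final identity\<close>

lemma mu_N: "2 * mu d (int N) = (\<Sum>x\<in>UNIV. quad_char (d * x ^ 3 + x))" for d :: 'a
proof -
  \<comment> \<open>With \<open>t = x ^ 2\<close> each square is hit twice, and \<open>ch N\<close>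
    at \<open>x ^ 2\<close> is the quadratic character of \<open>x\<close>.\<close>
  have "2 * mu d (int N) = (\<Sum>x\<in>UNIV - {0}. quad_char (1 + d * x\<^sup>2) * ch (int N) (x\<^sup>2))"
    unfolding mu_def sum_over_squares[symmetric] ..
  also have "\<dots> = (\<Sum>x\<in>UNIV - {0}. quad_char (d * x ^ 3 + x))"
  proof (rule sum.cong[OF refl])
    fix x :: 'a
    have "d * x ^ 3 + x = (1 + d * x\<^sup>2) * x"
      by (simp add: power2_eq_square power3_eq_cube algebra_simps)
    then show "quad_char (1 + d * x\<^sup>2) * ch (int N) (x\<^sup>2) = quad_char (d * x ^ 3 + x)"
      by (simp only: ch_of_square quad_char_mult)
  qed
  also have "\<dots> = (\<Sum>x\<in>UNIV. quad_char (d * x ^ 3 + x))"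
    by (rule sum.mono_neutral_left) auto
  finally show ?thesis .
qed

lemma card_square_roots: "of_nat (card {y :: 'a. y\<^sup>2 = u}) = 1 + quad_char u"
proof (cases "u = 0")
  case False
  show ?thesis
  proof (cases "u \<in> squares")
    case True
    then obtain y where y: "u = y\<^sup>2" by (auto simp: squares_def)
    \<comment> \<open>Characteristic 2 is excluded through the order of \<open>g\<close>:
      \<open>1 = -1\<close> would mean \<open>g ^ n = 1\<close>.\<close>
    have "y \<noteq> - y"
    proof
      assume "y = - y"
      then have "y * 1 = y * (- 1)" by simp
      then have "g ^ n = g ^ 0" using False y by (simp add: g_power_n)
      then show False unfolding g_facts(3) using n_pos by simp
    qed
    moreover have "{x. x\<^sup>2 = u} = {y, - y}" unfolding y by (auto simp: power2_eq_iff)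
    ultimately show ?thesis using True False by (simp add: quad_char_def)
  next
    case nsq: False
    then have "{y. y\<^sup>2 = u} = {}" by (auto simp: squares_def)
    then show ?thesis using nsq False by (simp add: quad_char_def)
  qed
qed simp

text \<open>Count the affine points fibre by fibre over \<open>x\<close>; the point at infinity
  cancels the 1 in \<open>q + 1\<close>.\<close>

lemma frob_trace_eq: "of_int (frob_trace d) = - (\<Sum>x\<in>UNIV. quad_char (d * x ^ 3 + x))" for d :: 'a
proof -
  have "card (X_points d) = Suc (card {(x, y). y\<^sup>2 = d * x ^ 3 + x})"
    unfolding X_points_def by (subst card_insert_disjoint) (auto simp: card_image)
  also have "{(x, y). y\<^sup>2 = d * x ^ 3 + x} = (SIGMA x:UNIV. {y. y\<^sup>2 = d * x ^ 3 + x})" by auto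
  also have "card \<dots> = (\<Sum>x\<in>UNIV. card {y. y\<^sup>2 = d * x ^ 3 + x})"
    by (rule card_SigmaI) auto
  finally have *: "card (X_points d) = Suc (\<Sum>x\<in>UNIV. card {y. y\<^sup>2 = d * x ^ 3 + x})" .
  have "(of_nat (card (X_points d)) :: complex) =
      1 + (\<Sum>x\<in>UNIV. 1 + quad_char (d * x ^ 3 + x))"
    by (simp add: * card_square_roots)
  then show ?thesis by (simp add: frob_trace_def sum.distrib)
qed

text \<open>Both sides equal \<open>4 * n * (-1) ^ (N - 1) * mu d N * (I_prod n chi) ^ 2\<close>:
  the factor \<open>2 ^ n = 4 ^ N\<close> absorbs the quarters from the \<open>N - 1\<close> pairs
  of eigenvalues.\<close>

lemma frob_trace_det:
  assumes s: "bij_betw s {0..n} squares" "s 0 = 0" and d: "d \<in> nonsquares"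
  shows "- of_int (frob_trace d) * (y_val n chi)\<^sup>2 = 2 ^ n * Determinant.det (T_mat n s d)"
proof -
  have e: "(n - 2) div 2 = N - 1" using n by simp
  have i: "(\<i> ^ (N - 1))\<^sup>2 = (- 1) ^ (N - 1)"
    by (simp add: power2_eq_square flip: power_mult_distrib)
  have q: "(complex_of_real (sqrt (real CARD('a) - 1)))\<^sup>2 = 2 * of_nat n"
    by (simp add: card_minus_1 flip: of_real_power)
  have y: "(y_val n chi)\<^sup>2 = (- 1) ^ (N - 1) * (I_prod n chi)\<^sup>2 * (2 * of_nat n)"
    unfolding y_val_def e power_mult_distrib i q ..
  have a: "- of_int (frob_trace d) = 2 * mu d (int N)"
    by (simp add: frob_trace_eq mu_N)
  obtain M where M: "N = Suc M" using N_pos by (cases N) auto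
  have p: "(2 :: complex) ^ n * (- 1 / 4) ^ (N - 1) = 4 * (- 1) ^ (N - 1)"
  proof -
    have "(2 :: complex) ^ n = 4 * 4 ^ (N - 1)" by (simp add: n M power_mult)
    moreover have "(4 :: complex) ^ (N - 1) * (- 1 / 4) ^ (N - 1) = (- 1) ^ (N - 1)"
      unfolding power_mult_distrib[symmetric] by simp
    ultimately show ?thesis by (simp only: mult.assoc)
  qed
  have "2 ^ n * Determinant.det (T_mat n s d) =
      of_nat n * mu d (int N) * (2 ^ n * (- 1 / 4) ^ (N - 1)) * (I_prod n chi)\<^sup>2"
    unfolding det_T_mat[OF s d] prod_mu[OF d] by (simp add: mult_ac)
  also have "\<dots> = 2 * mu d (int N) * (y_val n chi)\<^sup>2"
    unfolding p y by simp
  finally show ?thesis unfolding a ..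
qed

end

theorem theorem1p2:
  fixes n :: nat
    and chi :: "'a::{finite,field} \<Rightarrow> complex"
    and s :: "nat \<Rightarrow> 'a"
  assumes "CARD('a) = 2 * n + 1"
    and "CARD('a) \<ge> 7"
    and "CARD('a) mod 4 = 1"
    and "char_generator chi"
    and "bij_betw s {0..n} squares"
    and "s 0 = 0"
    and "s 1 = 1"
  shows "y_val n chi \<in> \<int> \<and>
    (\<forall>d::'a. d \<noteq> 0 \<and> d \<notin> squares \<longrightarrow>
       of_int (frob_trace d) = - (\<Sum>x\<in>UNIV. quad_char (d * x ^ 3 + x)) \<and>
       - of_int (frob_trace d) * (y_val n chi) ^ 2 = 2 ^ n * Determinant.det (T_mat n s d))"
proof -
  define N where "N = n div 2"
  have "even n" using assms(1,3) by presburger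
  then have n: "n = 2 * N" by (simp add: N_def)
  have N: "N > 0" using assms(1,2) n by simp
  \<comment> \<open>The group order is \<open>2 * n\<close>, so the normalized value is
    \<open>cis (pi / n)\<close>, as the locale requires.\<close>
  obtain g :: 'a where g: "bij_betw (\<lambda>i. g ^ i) {..<2 * n} (UNIV - {0})"
      "chi g = cis (2 * pi / real (2 * n))"
    using ex_normalized_generator[OF assms(4,1)] n N by auto
  interpret normalized_character g chi n N
    by unfold_locales (use assms n N g in \<open>auto simp: char_generator_def\<close>)
  show ?thesis
    using y_val_Ints frob_trace_eq frob_trace_det[OF assms(5,6)] by blast
qed

end
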